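(* Let $\mathbb{K}$ be a field, let $A$ be a unitary commutative (associative) algebra over $\mathbb{K}$ and let $\lambda\in\mathbb{K}$. Then $(\mathcal{F}_A^+,\diamond_\lambda,B_+^{1_A})$ is a Rota-Baxter algebra of weight $\lambda$. Furthermore, for any commutative associative Rota-Baxter algebra $(R,P)$ of weight $\lambda$ and any algebra homomorphism $\varphi:A\to R$, there is a Rota-Baxter algebra homomorphism $\bar\varphi:(\mathcal{F}_A^+,B_+^{1_A})\to(R,P)$ such that $\bar\varphi\circ j_A=\varphi$, where $j_A:A\to\mathcal{T}_A$ is the natural embedding. Furthermore, $\bar\varphi$ is the unique such Rota-Baxter algebra morphism with this property which is also a morphism for the concatenation product of trees.
   Context: Rooted forests are finite, non-planar (up to isomorphism), with vertices decorated by elements of $A$. $\mathcal{F}_A$ is the $\mathbb{K}$-vector space freely generated by rooted forests (including the empty forest $\emptyset$), $\mathcal{F}_A^+$ the subspace spanned by non-empty forests, $\mathcal{T}_A$ the subspace spanned by rooted trees. $|F|$ is the number of vertices of $F$. Concatenation (disjoint union) of forests is written by juxtaposition, is commutative and has unit $\emptyset$. For $a\in A$, the linear operator $B_+^a$ sends a forest $T_1\cdots T_k$ to the tree obtained by adding a new root decorated by $a$ linked to the root of each $T_i$. $j_A$ sends $a\in A$ to the one-vertex tree decorated by $a$. The bilinear products $\diamond_\lambda$ on $\mathcal{F}_A^+$ and $\ast_\lambda$ on $\mathcal{F}_A$ are defined by simultaneous recursion on $|f|+|f'|$: $f\ast_\lambda\emptyset=\emptyset\ast_\lambda f=f$. For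 non-empty trees, $B_+^a(F)\diamond_\lambda B_+^{a'}(F')=B_+^{aa'}(F\ast_\lambda F')$, with $aa'$ the product in $A$. For non-empty forests $f=T_1\cdots T_k$ and $f'=t_1\cdots t_n$ (with non-empty trees $T_i=B_+^{a_i}(f_i)$, $t_j=B_+^{a'_j}(f'_j)$) with $k+n\ge3$, $$f\diamond_\lambda f'=\frac1{kn}\sum_{i=1}^k\sum_{j=1}^n(T_i\diamond_\lambda t_j)\,T_1\cdots\widehat{T_i}\cdots T_k\,t_1\cdots\widehat{t_j}\cdots t_n,$$ and for all $k,n\ge1$, $$f\ast_\lambda f'=\frac1k\sum_{i=1}^kB_+^{a_i}(f_i\ast_\lambda f')\,T_1\cdots\widehat{T_i}\cdots T_k+\frac1n\sum_{j=1}^nB_+^{a'_j}(f\ast_\lambda f'_j)\,t_1\cdots\widehat{t_j}\cdots t_n+\lambda\,f\diamond_\lambda f'$$ (hats denote omission). A Rota-Baxter algebra of weight $\lambda$ is a pair $(R,P)$ with $R$ a (here not necessarily associative, unless stated) $\mathbb{K}$-algebra and $P:R\to R$ linear such that $P(x)P(y)=P(xP(y))+P(P(x)y)+\lambda P(xy)$ for all $x,y\in R$. A Rota-Baxter homomorphism $(R_1,P_1)\to(R_2,P_2)$ (same weight) is an algebra homomorphism $\bar f$ with $\bar f\circ P_1=P_2\circ\bar f$. Algebra homomorphisms $A\to R$ are unital ($\varphi(1_A)=1_R$). Being a morphism for the concatenation product means $\bar\varphi(T_1\cdots T_n)=\bar\varphi(T_1)\cdots\bar\varphi(T_n)$ for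 non-empty trees $T_1,\dots,T_n$.
   Formalization: The field K is taken to have characteristic zero, since the products use the factors 1/k and 1/(kn) for all k, n ≥ 1, which are undefined in characteristic p for forests with p trees. *)

theory Defs
  imports Complex_Main "HOL-Library.Multiset" "HOL-Library.Poly_Mapping"
begin

section \<open>Algebras and Rota-Baxter algebras\<close>

text \<open>
  Unitary commutative associative algebras. The sort \<open>{comm_ring, comm_monoid_mult}\<close> is that of
  commutative rings with unit; unlike \<open>comm_ring_1\<close> it does not exclude the zero ring.
\<close>

locale unital_comm_algebra = vector_space scale
  for scale :: "'k::field \<Rightarrow> 'a::{comm_ring, comm_monoid_mult} \<Rightarrow> 'a" +
  assumes scale_mult_left: "scale c (x * y) = scale c x * y"

locale unital_algebra_hom =
  dom: unital_comm_algebra scale1 + cod: unital_comm_algebra scale2 +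
  Vector_Spaces.linear scale1 scale2 \<phi>
  for scale1 :: "'k::field \<Rightarrow> 'a::{comm_ring, comm_monoid_mult} \<Rightarrow> 'a"
    and scale2 :: "'k \<Rightarrow> 'b::{comm_ring, comm_monoid_mult} \<Rightarrow> 'b"
    and \<phi> :: "'a \<Rightarrow> 'b" +
  assumes hom_mult: "\<phi> (x * y) = \<phi> x * \<phi> y"
    and hom_one: "\<phi> 1 = 1"

text \<open>
  A not necessarily associative (or unital) algebra, carried by a subspace \<open>S\<close> of a vector space;
  nothing is said about \<open>mult\<close> and \<open>P\<close> outside \<open>S\<close>.
\<close>

locale nonassoc_algebra = vector_space scale
  for scale :: "'k::field \<Rightarrow> 'v::ab_group_add \<Rightarrow> 'v"
    and S :: "'v set"
    and mult :: "'v \<Rightarrow> 'v \<Rightarrow> 'v" +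
  assumes subspace_carrier: "subspace S"
    and mult_closed: "\<lbrakk>x \<in> S; y \<in> S\<rbrakk> \<Longrightarrow> mult x y \<in> S"
    and mult_add_left: "\<lbrakk>x \<in> S; y \<in> S; z \<in> S\<rbrakk> \<Longrightarrow> mult (x + y) z = mult x z + mult y z"
    and mult_add_right: "\<lbrakk>x \<in> S; y \<in> S; z \<in> S\<rbrakk> \<Longrightarrow> mult x (y + z) = mult x y + mult x z"
    and mult_scale_left: "\<lbrakk>x \<in> S; y \<in> S\<rbrakk> \<Longrightarrow> mult (scale c x) y = scale c (mult x y)"
    and mult_scale_right: "\<lbrakk>x \<in> S; y \<in> S\<rbrakk> \<Longrightarrow> mult x (scale c y) = scale c (mult x y)"

locale rota_baxter_algebra = nonassoc_algebra scale S mult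
  for scale :: "'k::field \<Rightarrow> 'v::ab_group_add \<Rightarrow> 'v"
    and S :: "'v set"
    and mult :: "'v \<Rightarrow> 'v \<Rightarrow> 'v"
    and P :: "'v \<Rightarrow> 'v"
    and w :: 'k +
  assumes P_closed: "x \<in> S \<Longrightarrow> P x \<in> S"
    and P_add: "\<lbrakk>x \<in> S; y \<in> S\<rbrakk> \<Longrightarrow> P (x + y) = P x + P y"
    and P_scale: "x \<in> S \<Longrightarrow> P (scale c x) = scale c (P x)"
    and rota_baxter: "\<lbrakk>x \<in> S; y \<in> S\<rbrakk> \<Longrightarrow>
      mult (P x) (P y) = P (mult x (P y)) + P (mult (P x) y) + scale w (P (mult x y))"

locale rota_baxter_hom =
  dom: rota_baxter_algebra scale1 S1 mult1 P1 w +
  cod: rota_baxter_algebra scale2 S2 mult2 P2 w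
  for scale1 :: "'k::field \<Rightarrow> 'v::ab_group_add \<Rightarrow> 'v" and S1 mult1 P1
    and scale2 :: "'k \<Rightarrow> 'u::ab_group_add \<Rightarrow> 'u" and S2 mult2 P2
    and w :: 'k
    and h :: "'v \<Rightarrow> 'u" +
  assumes hom_closed: "x \<in> S1 \<Longrightarrow> h x \<in> S2"
    and hom_add: "\<lbrakk>x \<in> S1; y \<in> S1\<rbrakk> \<Longrightarrow> h (x + y) = h x + h y"
    and hom_scale: "x \<in> S1 \<Longrightarrow> h (scale1 c x) = scale2 c (h x)"
    and hom_mult: "\<lbrakk>x \<in> S1; y \<in> S1\<rbrakk> \<Longrightarrow> h (mult1 x y) = mult2 (h x) (h y)"
    and hom_P: "x \<in> S1 \<Longrightarrow> h (P1 x) = P2 (h x)"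


section \<open>Decorated rooted forests\<close>

datatype 'a rtree = Node (root: 'a) (children: "'a rtree multiset")

type_synonym 'a forest = "'a rtree multiset"

text \<open>
  The space spanned by all forests. The ring structure of \<^typ>\<open>'a forest \<Rightarrow>\<^sub>0 'k\<close>, convolution along
  the union of multisets, is the bilinear extension of concatenation, with unit the empty forest.
\<close>

type_synonym ('a, 'k) forest_space = "'a forest \<Rightarrow>\<^sub>0 'k"

primrec tree_vertices :: "'a rtree \<Rightarrow> nat" where
  "tree_vertices (Node a F) = Suc (sum_mset (image_mset tree_vertices F))"

definition vertices :: "'a forest \<Rightarrow> nat" where
  "vertices F = (\<Sum>T\<in>#F. tree_vertices T)"

definition forest_scale :: "'k::field \<Rightarrow> ('a, 'k) forest_space \<Rightarrow> ('a, 'k) forest_space" where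
  "forest_scale c x = Poly_Mapping.map ((*) c) x"

definition basis :: "'a forest \<Rightarrow> ('a, 'k::field) forest_space" where
  "basis F = Poly_Mapping.single F 1"

definition nonempty_forests :: "('a, 'k::field) forest_space set" where
  "nonempty_forests = {x. {#} \<notin> Poly_Mapping.keys x}"

definition B_plus :: "'a \<Rightarrow> ('a, 'k::field) forest_space \<Rightarrow> ('a, 'k) forest_space" where
  "B_plus a x =
    (\<Sum>F\<in>Poly_Mapping.keys x. forest_scale (Poly_Mapping.lookup x F) (basis {#Node a F#}))"

definition single_vertex :: "'a \<Rightarrow> ('a, 'k::field) forest_space" where
  "single_vertex a = basis {#Node a {#}#}"


section \<open>The two products\<close>

lemma vertices_simps [simp]:
  "vertices {#} = 0" "vertices (add_mset T F) = tree_vertices T + vertices F"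
  by (simp_all add: vertices_def)

lemma vertices_children: "tree_vertices T = Suc (vertices (children T))"
  by (cases T) (simp add: vertices_def)

lemma tree_vertices_le: "T \<in># F \<Longrightarrow> tree_vertices T \<le> vertices F"
  by (auto dest!: multi_member_split)

lemma sum_mset_image_cong [fundef_cong]:
  "\<lbrakk>M = N; \<And>x. x \<in># N \<Longrightarrow> f x = g x\<rbrakk> \<Longrightarrow> image_mset f M = image_mset g N"
  by (rule multiset.map_cong)

text \<open>
  The products of basis elements. The double sum defining \<open>forest_diamond\<close> also covers
  \<open>k = n = 1\<close>, where it reduces to the product of two trees (lemma \<open>forest_diamond_tree\<close> below).
  The factors \<open>1 / k\<close> and \<open>1 / n\<close> only make sense for all forests in characteristic zero.
\<close>

function
      tree_diamond :: "'k::field_char_0 \<Rightarrow> 'a::times rtree \<Rightarrow> 'a rtree \<Rightarrow> ('a, 'k) forest_space"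
  and forest_diamond :: "'k \<Rightarrow> 'a forest \<Rightarrow> 'a forest \<Rightarrow> ('a, 'k) forest_space"
  and forest_star :: "'k \<Rightarrow> 'a forest \<Rightarrow> 'a forest \<Rightarrow> ('a, 'k) forest_space"
  where
  "tree_diamond w T t = B_plus (root T * root t) (forest_star w (children T) (children t))"
| "forest_diamond w f f' =
    forest_scale (1 / (of_nat (size f) * of_nat (size f')))
      (\<Sum>T\<in>#f. \<Sum>t\<in>#f'. tree_diamond w T t * basis (f - {#T#}) * basis (f' - {#t#}))"
| "forest_star w f f' =
    (if f = {#} then basis f'
     else if f' = {#} then basis f
     else
       forest_scale (1 / of_nat (size f))
         (\<Sum>T\<in>#f. B_plus (root T) (forest_star w (children T) f') * basis (f - {#T#}))
       + forest_scale (1 / of_nat (size f'))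
         (\<Sum>t\<in>#f'. B_plus (root t) (forest_star w f (children t)) * basis (f' - {#t#}))
       + forest_scale w (forest_diamond w f f'))"
  by pat_completeness auto

termination
  by (relation "measures
      [case_sum (\<lambda>(w, T, t). tree_vertices T + tree_vertices t)
        (case_sum (\<lambda>(w, f, f'). vertices f + vertices f') (\<lambda>(w, f, f'). vertices f + vertices f')),
       case_sum (\<lambda>_. 0) (case_sum (\<lambda>_. 1) (\<lambda>_. 2))]")
    (auto simp: vertices_children order.strict_iff_order dest!: tree_vertices_le)

declare tree_diamond.simps [simp del] forest_diamond.simps [simp del] forest_star.simps [simp del]

definition bilinear_extension ::
  "('a forest \<Rightarrow> 'a forest \<Rightarrow> ('a, 'k::field) forest_space) \<Rightarrow>
    ('a, 'k) forest_space \<Rightarrow> ('a, 'k) forest_space \<Rightarrow> ('a, 'k) forest_space" where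
  "bilinear_extension p x y =
    (\<Sum>f\<in>Poly_Mapping.keys x. \<Sum>f'\<in>Poly_Mapping.keys y.
      forest_scale (Poly_Mapping.lookup x f * Poly_Mapping.lookup y f') (p f f'))"

definition diamond :: "'k::field_char_0 \<Rightarrow>
    ('a::times, 'k) forest_space \<Rightarrow> ('a, 'k) forest_space \<Rightarrow> ('a, 'k) forest_space" where
  "diamond w = bilinear_extension (forest_diamond w)"

lemma forest_diamond_tree:
  fixes T t :: "'a::times rtree" and w :: "'k::field_char_0"
  shows "forest_diamond w {#T#} {#t#} = tree_diamond w T t"
proof -
  have "basis {#} = (1 :: ('a, 'k) forest_space)"
    by (simp add: basis_def flip: single_one)
  moreover have "forest_scale 1 x = x" for x :: "('a, 'k) forest_space"
    by (rule poly_mapping_eqI) (simp add: forest_scale_def Poly_Mapping.map.rep_eq when_def)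
  ultimately show ?thesis
    by (simp add: forest_diamond.simps)
qed

definition concatenation_hom ::
  "(('a, 'k::field) forest_space \<Rightarrow> 'r::comm_monoid_mult) \<Rightarrow> bool" where
  "concatenation_hom h \<longleftrightarrow> (\<forall>F. F \<noteq> {#} \<longrightarrow> h (basis F) = (\<Prod>T\<in>#F. h (basis {#T#})))"

end

theory Submission
  imports Defs
begin

text \<open>
  \<^emph>\<open>The Rota-Baxter identity.\<close> Since \<open>B\<^sub>+\<^sup>a(F) \<diamond> B\<^sub>+\<^sup>b(G) = B\<^sub>+\<^sup>a\<^sup>b(F \<star> G)\<close>, the identity for
  \<open>P = B\<^sub>+\<^sup>1\<close> asks that \<open>f \<star> f' = f \<diamond> B\<^sub>+\<^sup>1(f') + B\<^sub>+\<^sup>1(f) \<diamond> f' + w (f \<diamond> f')\<close> for non-empty forests.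
  Because \<open>B\<^sub>+\<^sup>1(f')\<close> is a single tree whose root is decorated by the unit, expanding
  \<open>f \<diamond> B\<^sub>+\<^sup>1(f')\<close> gives exactly the first average in the recursion of \<open>\<star>\<close>, and symmetrically for
  the second (\<open>forest_star_eq_diamonds\<close>).

  \<^emph>\<open>The extension.\<close> Let \<open>R\<close> be commutative and associative. From
  \<open>B\<^sub>+\<^sup>a(F) = j(a) \<diamond> B\<^sub>+\<^sup>1(F)\<close>, any Rota-Baxter morphism extending \<open>\<phi>\<close> satisfies
  \<open>h(B\<^sub>+\<^sup>a(F)) = \<phi>(a) P(h(F))\<close> for \<open>F\<close> non-empty and \<open>h(B\<^sub>+\<^sup>a(\<emptyset>)) = \<phi>(a)\<close>. Together with
  multiplicativity for concatenation this determines \<open>h\<close> by recursion on trees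
  (\<open>extension_unique\<close>), and the same recursion serves to define it.

  That the map so defined respects \<open>\<diamond>\<close> comes from a companion map \<open>e\<close> on the whole space of
  forests, with \<open>e(\<emptyset>) = 1\<close> and \<open>e(F) = P(h(F))\<close> otherwise, for which \<open>h(B\<^sub>+\<^sup>a(x)) = \<phi>(a) e(x)\<close>
  without exception. The heart of the proof is that \<open>e\<close> turns \<open>\<star>\<close> into the product of \<open>R\<close>
  (\<open>grafted_extension_forest_star\<close>), by induction on the number of vertices. Within each of the
  three averages defining \<open>f \<star> f'\<close>, all summands then have the same image under \<open>h\<close>, because in a
  commutative target the value of a removed tree can be multiplied back in; the factors \<open>1 / k\<close>
  and \<open>1 / n\<close> turn the sums into \<open>h(f) P(h(f'))\<close>, \<open>P(h(f)) h(f')\<close> and \<open>w h(f) h(f')\<close>, and \<open>P\<close> of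
  their total is \<open>P(h(f)) P(h(f'))\<close> by the Rota-Baxter identity in \<open>R\<close>.
\<close>

section \<open>Linear algebra in the space of forests\<close>

lemma lookup_forest_scale [simp]:
  "Poly_Mapping.lookup (forest_scale c x) F = c * Poly_Mapping.lookup x F"
  by (simp add: forest_scale_def Poly_Mapping.map.rep_eq when_def)

interpretation forest: vector_space "forest_scale :: 'k::field \<Rightarrow> ('a, 'k) forest_space \<Rightarrow> _"
  by unfold_locales (auto intro!: poly_mapping_eqI simp: lookup_add algebra_simps)

text \<open>
  Scaling is multiplication by a multiple of the unit, so its compatibility with concatenation
  is associativity of the ring of forests.
\<close>

lemma forest_scale_eq_mult: "forest_scale c x = Poly_Mapping.single {#} c * x"
  by (simp add: forest_scale_def mult_map_scale_conv_mult)

lemma forest_scale_mult_left: "forest_scale c x * y = forest_scale c (x * y)"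
  by (simp add: forest_scale_eq_mult mult.assoc)

lemma basis_mult: "basis F * basis G = basis (F + G)"
  by (simp add: basis_def mult_single)

lemma basis_empty: "basis {#} = 1"
  by (simp add: basis_def)

lemma keys_basis [simp]: "Poly_Mapping.keys (basis F :: ('a, 'k::field) forest_space) = {F}"
  by (simp add: basis_def)

lemma lookup_basis [simp]: "Poly_Mapping.lookup (basis F) F = 1"
  by (simp add: basis_def)

lemma forest_space_induct [consumes 1, case_names zero step]:
  fixes x :: "('a, 'k::field) forest_space"
  assumes "Poly_Mapping.keys x \<subseteq> U"
    and zero: "Q 0"
    and step: "\<And>c F y. F \<in> U \<Longrightarrow> Poly_Mapping.keys y \<subseteq> U \<Longrightarrow> Q y \<Longrightarrow>
      Q (forest_scale c (basis F) + y)"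
  shows "Q x"
proof -
  let ?m = "\<lambda>F. forest_scale (Poly_Mapping.lookup x F) (basis F)"
  have "Poly_Mapping.keys (sum ?m A) \<subseteq> U \<and> Q (sum ?m A)" if "finite A" "A \<subseteq> U" for A
    using that
  proof (induction A)
    case (insert F A)
    moreover have "Poly_Mapping.keys (?m F) \<subseteq> {F}"
      by (auto simp: in_keys_iff basis_def lookup_single when_def split: if_splits)
    ultimately show ?case
      using keys_add[of "?m F" "sum ?m A"] by (auto intro: step)
  qed (simp add: zero)
  moreover have "x = sum ?m (Poly_Mapping.keys x)"
    by (rule poly_mapping_eqI)
      (auto simp: lookup_sum basis_def lookup_single when_def in_keys_iff if_distrib sum.delta cong: if_cong)
  ultimately show ?thesis
    using assms(1) by (metis finite_keys)
qed

definition linear_extension ::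
  "('k::field \<Rightarrow> 'v::ab_group_add \<Rightarrow> 'v) \<Rightarrow> ('a forest \<Rightarrow> 'v) \<Rightarrow> ('a, 'k) forest_space \<Rightarrow> 'v" where
  "linear_extension s g x = (\<Sum>F\<in>Poly_Mapping.keys x. s (Poly_Mapping.lookup x F) (g F))"

context vector_space
begin

lemma linear_extension_superset:
  assumes "finite A" "Poly_Mapping.keys x \<subseteq> A"
  shows "linear_extension scale g x = (\<Sum>F\<in>A. scale (Poly_Mapping.lookup x F) (g F))"
  unfolding linear_extension_def
  by (rule sum.mono_neutral_left) (use assms in \<open>auto simp: in_keys_iff\<close>)

text \<open>
  \<open>B_plus\<close>, the product \<open>diamond\<close> and the extension of \<open>\<phi>\<close> are all built from
  \<open>linear_extension\<close> and inherit their linearity from here.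
\<close>

lemma linear_linear_extension:
  "Vector_Spaces.linear forest_scale scale (linear_extension scale g)"
proof -
  have "linear_extension scale g (x + y) = linear_extension scale g x + linear_extension scale g y"
    for x y
  proof -
    let ?A = "Poly_Mapping.keys x \<union> Poly_Mapping.keys y"
    have "linear_extension scale g z = (\<Sum>F\<in>?A. scale (Poly_Mapping.lookup z F) (g F))"
      if "z = x \<or> z = y \<or> z = x + y" for z
      using that keys_add[of x y] by (intro linear_extension_superset) auto
    then show ?thesis
      by (simp add: lookup_add scale_left_distrib sum.distrib)
  qed
  moreover have "linear_extension scale g (forest_scale c x) = scale c (linear_extension scale g x)"
    for c x
  proof -
    have "linear_extension scale g (forest_scale c x) =
      (\<Sum>F\<in>Poly_Mapping.keys x. scale (Poly_Mapping.lookup (forest_scale c x) F) (g F))"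
      by (rule linear_extension_superset) (auto simp: in_keys_iff)
    then show ?thesis
      by (simp add: linear_extension_def scale_sum_right)
  qed
  ultimately show ?thesis
    by unfold_locales
qed

lemma linear_extension_basis [simp]: "linear_extension scale g (basis F) = g F"
  by (simp add: linear_extension_def)

lemma sum_mset_constant_scale:
  fixes z :: 'b
  shows "(\<Sum>T\<in>#f. z) = scale (of_nat (size f)) z"
  by (induction f) (simp_all add: scale_left_distrib)

end

text \<open>
  Characteristic zero makes \<open>of_nat (size f)\<close> invertible for every non-empty forest.
\<close>

lemma average_constant:
  fixes s :: "'k::field_char_0 \<Rightarrow> 'v::ab_group_add \<Rightarrow> 'v"
  assumes "vector_space s" and "f \<noteq> {#}"
  shows "s (1 / of_nat (size f)) (\<Sum>T\<in>#f. z) = z"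
proof -
  interpret vector_space s by fact
  show ?thesis
    using assms(2) by (simp add: sum_mset_constant_scale)
qed

lemma (in module_hom) sum_mset: "f (\<Sum>x\<in>#M. h x) = (\<Sum>x\<in>#M. f (h x))"
  by (induction M) (simp_all add: add)

section \<open>The Rota-Baxter algebra of non-empty forests\<close>

interpretation B_plus: Vector_Spaces.linear forest_scale forest_scale "B_plus a"
  using forest.linear_linear_extension
  by (simp add: B_plus_def [abs_def] linear_extension_def [abs_def])

lemma B_plus_basis [simp]: "B_plus a (basis F) = basis {#Node a F#}"
  by (simp add: B_plus_def)

lemma forest_star_empty [simp]:
  "forest_star w {#} f' = basis f'" "forest_star w f {#} = basis f"
  by (simp_all add: forest_star.simps)

lemma B_plus_nonempty: "B_plus a x \<in> nonempty_forests"
  using keys_sum[of "\<lambda>F. forest_scale (Poly_Mapping.lookup x F) (basis {#Node a F#})" "Poly_Mapping.keys x"]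
  by (auto simp: nonempty_forests_def B_plus_def in_keys_iff lookup_sum basis_def lookup_single)

lemma subspace_nonempty_forests: "forest.subspace nonempty_forests"
  by (rule forest.subspaceI)
    (auto simp: nonempty_forests_def in_keys_iff lookup_add)

lemma basis_nonempty [simp]: "basis F \<in> nonempty_forests \<longleftrightarrow> F \<noteq> {#}"
  by (auto simp: nonempty_forests_def)

lemma nonempty_forests_mult_right: "x \<in> nonempty_forests \<Longrightarrow> x * y \<in> nonempty_forests"
  using keys_mult[of x y] by (auto simp: nonempty_forests_def)

lemma nonempty_forests_sum_mset:
  "(\<And>T. T \<in># f \<Longrightarrow> h T \<in> nonempty_forests) \<Longrightarrow> (\<Sum>T\<in>#f. h T) \<in> nonempty_forests"
  by (induction f)
    (auto intro: forest.subspace_0 [OF subspace_nonempty_forests]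
      forest.subspace_add [OF subspace_nonempty_forests])

lemmas nonempty_forests_closed =
  forest.subspace_add [OF subspace_nonempty_forests]
  forest.subspace_scale [OF subspace_nonempty_forests]
  nonempty_forests_mult_right nonempty_forests_sum_mset B_plus_nonempty

lemma forest_diamond_nonempty: "forest_diamond w f f' \<in> nonempty_forests"
  by (simp add: forest_diamond.simps tree_diamond.simps nonempty_forests_closed)

text \<open>
  Each summand of the recursion has a factor in the image of some \<open>B_plus a\<close>, so it lies in the
  span of the non-empty forests whatever the recursive call returns.
\<close>

lemma forest_star_nonempty: "f \<noteq> {#} \<or> f' \<noteq> {#} \<Longrightarrow> forest_star w f f' \<in> nonempty_forests"
  by (auto simp: forest_star.simps[of w f f'] forest_diamond_nonempty nonempty_forests_closed)

text \<open>
  Writing the double sum as an iterated linear extension gives linearity in the outer variable at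
  once; linearity in the inner variable then holds termwise.
\<close>

lemma diamond_eq_linear_extension:
  "diamond w x y =
    linear_extension forest_scale (\<lambda>f. linear_extension forest_scale (forest_diamond w f) y) x"
  by (simp add: diamond_def bilinear_extension_def linear_extension_def forest.scale_sum_right)

interpretation diamond_left: Vector_Spaces.linear forest_scale forest_scale "\<lambda>x. diamond w x y"
  unfolding diamond_eq_linear_extension by (rule forest.linear_linear_extension)

interpretation diamond_right: Vector_Spaces.linear forest_scale forest_scale "diamond w x"
proof -
  interpret L: Vector_Spaces.linear forest_scale forest_scale
    "linear_extension forest_scale (forest_diamond w f)" for f
    by (rule forest.linear_linear_extension)
  show "Vector_Spaces.linear forest_scale forest_scale (diamond w x)"
    by unfold_locales
      (simp_all add: diamond_eq_linear_extension linear_extension_def[of _ _ x] L.add L.scale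
        forest.scale_right_distrib sum.distrib forest.scale_sum_right mult.commute)
qed

lemma diamond_basis [simp]: "diamond w (basis f) (basis f') = forest_diamond w f f'"
  by (simp add: diamond_eq_linear_extension)

lemma diamond_nonempty: "diamond w x y \<in> nonempty_forests"
  unfolding diamond_def bilinear_extension_def
  by (intro forest.subspace_sum forest.subspace_scale subspace_nonempty_forests forest_diamond_nonempty)

lemma nonempty_forests_induct [consumes 1, case_names zero step]:
  fixes x :: "('a, 'k::field) forest_space"
  assumes "x \<in> nonempty_forests" and "Q 0"
    and "\<And>c F y. F \<noteq> {#} \<Longrightarrow> y \<in> nonempty_forests \<Longrightarrow> Q y \<Longrightarrow>
      Q (forest_scale c (basis F) + y)"
  shows "Q x"
proof -
  have *: "z \<in> nonempty_forests \<longleftrightarrow> Poly_Mapping.keys z \<subseteq> - {{#}}" for z :: "('a, 'k) forest_space"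
    by (auto simp: nonempty_forests_def)
  show ?thesis
    using assms(1) unfolding *
    by (induction x rule: forest_space_induct) (use assms(2,3) * in blast)+
qed

text \<open>
  The Rota-Baxter identity before grafting. The average over a single tree is trivial, and the
  decoration of its root is the unit, so multiplying \<open>f\<close> by \<open>{#Node 1 f'#}\<close> leaves the decorations
  of the roots of \<open>f\<close> unchanged and star-multiplies the children of one root by \<open>f'\<close>.
\<close>

lemma forest_star_eq_diamonds:
  fixes f f' :: "'a::monoid_mult forest"
  assumes "f \<noteq> {#}" "f' \<noteq> {#}"
  shows "forest_star w f f' = forest_diamond w f {#Node 1 f'#} + forest_diamond w {#Node 1 f#} f'
    + forest_scale w (forest_diamond w f f')"
  using assms
  by (simp add: forest_star.simps[of w f f'] forest_diamond.simps[of w f "{#_#}"]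
     forest_diamond.simps[of w "{#_#}"] tree_diamond.simps basis_empty)

lemma diamond_rota_baxter:
  fixes x y :: "('a::monoid_mult, 'k::field_char_0) forest_space"
  assumes "x \<in> nonempty_forests" and "y \<in> nonempty_forests"
  shows "diamond w (B_plus 1 x) (B_plus 1 y) =
    B_plus 1 (diamond w x (B_plus 1 y)) + B_plus 1 (diamond w (B_plus 1 x) y)
    + forest_scale w (B_plus 1 (diamond w x y))"
  using assms(1)
proof (induction x rule: nonempty_forests_induct)
  case (step c F x)
  have "diamond w (basis {#Node 1 F#}) (B_plus 1 y) =
    B_plus 1 (diamond w (basis F) (B_plus 1 y)) + B_plus 1 (diamond w (basis {#Node 1 F#}) y)
    + forest_scale w (B_plus 1 (diamond w (basis F) y))"
    using assms(2)
  proof (induction y rule: nonempty_forests_induct)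
    case (step d G y)
    have "forest_diamond w {#Node 1 F#} {#Node 1 G#} =
      B_plus 1 (forest_diamond w F {#Node 1 G#}) + B_plus 1 (forest_diamond w {#Node 1 F#} G)
      + forest_scale w (B_plus 1 (forest_diamond w F G))"
      using \<open>F \<noteq> {#}\<close> step.hyps
      by (simp add: forest_diamond_tree tree_diamond.simps forest_star_eq_diamonds B_plus.add B_plus.scale)
    with step show ?case
      by (simp add: B_plus.add B_plus.scale diamond_right.add diamond_right.scale
        forest.scale_right_distrib algebra_simps)
  qed simp
  with step show ?case
    by (simp add: B_plus.add B_plus.scale diamond_left.add diamond_left.scale
      forest.scale_right_distrib algebra_simps)
qed simp

lemma rota_baxter_nonempty_forests:
  "rota_baxter_algebra forest_scale
    (nonempty_forests :: ('a::monoid_mult, 'k::field_char_0) forest_space set) (diamond w) (B_plus 1) w"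
  by unfold_locales
    (auto intro: subspace_nonempty_forests diamond_nonempty B_plus_nonempty diamond_rota_baxter
      simp: diamond_left.add diamond_left.scale diamond_right.add diamond_right.scale B_plus.add B_plus.scale)

section \<open>The universal property\<close>

text \<open>
  The value forced on a tree by \<open>Node a F = Node a {#} \<diamond> Node 1 F\<close>: a leaf goes to \<open>\<phi> a\<close>, without
  any occurrence of \<open>P\<close>.
\<close>

primrec tree_value :: "('a \<Rightarrow> 'r) \<Rightarrow> ('r \<Rightarrow> 'r) \<Rightarrow> 'a rtree \<Rightarrow> 'r::comm_monoid_mult" where
  "tree_value \<phi> P (Node a F) =
    \<phi> a * (if F = {#} then 1 else P (\<Prod>\<^sub># (image_mset (tree_value \<phi> P) F)))"

locale rota_baxter_target =
  unital_comm_algebra scaleR + R: rota_baxter_algebra scaleR UNIV "(*)" P w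
  for scaleR :: "'k::field_char_0 \<Rightarrow> 'r::{comm_ring, comm_monoid_mult} \<Rightarrow> 'r"
    and P :: "'r \<Rightarrow> 'r" and w :: 'k +
  fixes \<phi> :: "'a::monoid_mult \<Rightarrow> 'r"
  assumes phi_mult: "\<phi> (a * b) = \<phi> a * \<phi> b"
    and phi_one: "\<phi> 1 = 1"
begin

abbreviation value_of_tree :: "'a rtree \<Rightarrow> 'r" where
  "value_of_tree \<equiv> tree_value \<phi> P"

definition forest_value :: "'a forest \<Rightarrow> 'r" where
  "forest_value F = (\<Prod>T\<in>#F. value_of_tree T)"

text \<open>
  The contribution of the subforest above a root. Setting it to \<open>1\<close> on the empty forest, where
  \<open>P 1\<close> would be the naive choice, makes \<open>B_plus a\<close> correspond to multiplication by \<open>\<phi> a\<close> on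
  every forest.
\<close>

definition grafted_value :: "'a forest \<Rightarrow> 'r" where
  "grafted_value F = (if F = {#} then 1 else P (forest_value F))"

definition extension :: "('a, 'k) forest_space \<Rightarrow> 'r" where
  "extension = linear_extension scaleR forest_value"

definition grafted_extension :: "('a, 'k) forest_space \<Rightarrow> 'r" where
  "grafted_extension = linear_extension scaleR grafted_value"

sublocale extension: Vector_Spaces.linear forest_scale scaleR extension
  unfolding extension_def by (rule linear_linear_extension)

sublocale grafted_extension: Vector_Spaces.linear forest_scale scaleR grafted_extension
  unfolding grafted_extension_def by (rule linear_linear_extension)

sublocale P: Vector_Spaces.linear scaleR scaleR P
  by unfold_locales (simp_all add: R.P_add R.P_scale)

lemma scale_mult_right: "x * scaleR c y = scaleR c (x * y)"
  by (metis mult.commute scale_mult_left)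

lemma extension_basis [simp]: "extension (basis F) = forest_value F"
  by (simp add: extension_def)

lemma grafted_extension_basis [simp]: "grafted_extension (basis F) = grafted_value F"
  by (simp add: grafted_extension_def)

lemma forest_value_simps [simp]:
  "forest_value {#} = 1"
  "forest_value (add_mset T F) = value_of_tree T * forest_value F"
  by (simp_all add: forest_value_def)

lemma forest_value_union: "forest_value (F + G) = forest_value F * forest_value G"
  by (simp add: forest_value_def)

lemma forest_value_remove: "T \<in># F \<Longrightarrow> value_of_tree T * forest_value (F - {#T#}) = forest_value F"
  by (metis forest_value_simps(2) insert_DiffM)

lemma value_of_tree_eq: "value_of_tree T = \<phi> (root T) * grafted_value (children T)"
  by (cases T) (simp add: grafted_value_def forest_value_def)

declare tree_value.simps [simp del]

lemma extension_mult_basis: "extension (x * basis G) = extension x * forest_value G"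
  using subset_UNIV
proof (induction x rule: forest_space_induct)
  case (step c F x)
  then show ?case
    by (simp add: distrib_right forest_scale_mult_left basis_mult extension.add extension.scale
      forest_value_union scale_mult_left)
qed simp_all

lemma extension_B_plus: "extension (B_plus a x) = \<phi> a * grafted_extension x"
  using subset_UNIV
proof (induction x rule: forest_space_induct)
  case (step c F x)
  then show ?case
    by (simp add: B_plus.add B_plus.scale extension.add extension.scale grafted_extension.add
      grafted_extension.scale distrib_left value_of_tree_eq scale_mult_right)
qed simp_all

lemma grafted_extension_nonempty:
  "x \<in> nonempty_forests \<Longrightarrow> grafted_extension x = P (extension x)"
proof (induction x rule: nonempty_forests_induct)
  case (step c F x)
  then show ?case
    by (simp add: P.add P.scale extension.add extension.scale grafted_extension.add
      grafted_extension.scale grafted_value_def)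
qed simp_all

text \<open>
  All pairs \<open>(T, t)\<close> contribute equally, as the value of \<open>T\<close> and of \<open>t\<close> complete those of
  \<open>f - {#T#}\<close> and \<open>f' - {#t#}\<close>. The multiplicativity of \<open>grafted_extension\<close> appears as a
  hypothesis because this is used inside the induction that establishes it.
\<close>

lemma extension_forest_diamond:
  assumes "f \<noteq> {#}" "f' \<noteq> {#}"
    and "\<And>T t. T \<in># f \<Longrightarrow> t \<in># f' \<Longrightarrow> grafted_extension (forest_star w (children T) (children t))
      = grafted_value (children T) * grafted_value (children t)"
  shows "extension (forest_diamond w f f') = forest_value f * forest_value f'"
proof -
  have "extension (tree_diamond w T t * basis (f - {#T#}) * basis (f' - {#t#}))
      = forest_value f * forest_value f'" if "T \<in># f" "t \<in># f'" for T t
  proof -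
    have "extension (tree_diamond w T t * basis (f - {#T#}) * basis (f' - {#t#}))
      = (value_of_tree T * forest_value (f - {#T#})) * (value_of_tree t * forest_value (f' - {#t#}))"
      unfolding tree_diamond.simps extension_mult_basis extension_B_plus phi_mult value_of_tree_eq
        assms(3)[OF that]
      by (simp only: mult_ac)
    then show ?thesis
      using that by (simp add: forest_value_remove)
  qed
  then have "extension (forest_diamond w f f') =
      scaleR (1 / of_nat (size f)) (scaleR (1 / of_nat (size f'))
        (\<Sum>T\<in>#f. \<Sum>t\<in>#f'. forest_value f * forest_value f'))"
    by (simp add: forest_diamond.simps extension.scale extension.sum_mset cong: image_mset_cong)
  also have "\<dots> = forest_value f * forest_value f'"
    using assms(1,2) by (simp add: sum_mset_constant_scale)
  finally show ?thesis .
qed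

text \<open>
  Covers both one-sided averages of the star product: \<open>x T\<close> is the star product of the children of
  \<open>T\<close> with the other factor, and \<open>c\<close> is the grafted value of that factor.
\<close>

lemma extension_average_grafted:
  assumes "f \<noteq> {#}"
    and "\<And>T. T \<in># f \<Longrightarrow> grafted_extension (x T) = grafted_value (children T) * c"
  shows "extension (forest_scale (1 / of_nat (size f))
      (\<Sum>T\<in>#f. B_plus (root T) (x T) * basis (f - {#T#}))) = forest_value f * c"
proof -
  have "extension (B_plus (root T) (x T) * basis (f - {#T#})) = forest_value f * c"
    if "T \<in># f" for T
    unfolding extension_mult_basis extension_B_plus assms(2)[OF that]
      forest_value_remove[OF that, symmetric] value_of_tree_eq
    by (simp only: mult_ac)
  then show ?thesis
    using average_constant[OF vector_space_axioms assms(1)]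
    by (simp add: extension.scale extension.sum_mset cong: image_mset_cong)
qed

text \<open>
  \<open>grafted_extension\<close> is an algebra morphism for the star product. For non-empty forests it is \<open>P\<close>
  of the three averages, which is the right-hand side of the Rota-Baxter identity in \<open>R\<close>; the
  empty forest is the unit on both sides.
\<close>

lemma grafted_extension_forest_star:
  "grafted_extension (forest_star w f f') = grafted_value f * grafted_value f'"
proof (induction "vertices f + vertices f'" arbitrary: f f' rule: less_induct)
  case less
  have smaller: "vertices (children T) < vertices F" if "T \<in># F" for T and F :: "'a forest"
    using tree_vertices_le[OF that] by (simp add: vertices_children)
  have left: "grafted_extension (forest_star w (children T) f') =
      grafted_value (children T) * grafted_value f'" if "T \<in># f" for T
    using smaller[OF that] by (intro less) simp
  have right: "grafted_extension (forest_star w f (children t)) =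
      grafted_value f * grafted_value (children t)" if "t \<in># f'" for t
    using smaller[OF that] by (intro less) simp
  have both: "grafted_extension (forest_star w (children T) (children t)) =
      grafted_value (children T) * grafted_value (children t)" if "T \<in># f" "t \<in># f'" for T t
    using smaller[OF that(1)] smaller[OF that(2)] by (intro less) simp
  consider "f = {#}" | "f' = {#}" | "f \<noteq> {#}" "f' \<noteq> {#}"
    by blast
  then show ?case
  proof cases
    case 3
    have "extension (forest_star w f f') = forest_value f * P (forest_value f')
      + P (forest_value f) * forest_value f' + scaleR w (forest_value f * forest_value f')"
    proof -
      have "extension (forest_scale (1 / of_nat (size f))
         (\<Sum>T\<in>#f. B_plus (root T) (forest_star w (children T) f') * basis (f - {#T#}))) =
         forest_value f * P (forest_value f')"
        using 3 by (intro extension_average_grafted) (simp_all add: left grafted_value_def[of f'])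
      moreover have "extension (forest_scale (1 / of_nat (size f'))
         (\<Sum>t\<in>#f'. B_plus (root t) (forest_star w f (children t)) * basis (f' - {#t#}))) =
         forest_value f' * P (forest_value f)"
        using 3 by (intro extension_average_grafted)
          (simp_all add: right grafted_value_def[of f] mult.commute)
      moreover have "extension (forest_diamond w f f') = forest_value f * forest_value f'"
        using 3 by (intro extension_forest_diamond both)
      ultimately show ?thesis
        using 3 by (simp add: forest_star.simps[of w f f'] extension.add extension.scale mult.commute)
    qed
    moreover have "grafted_extension (forest_star w f f') = P (extension (forest_star w f f'))"
      using 3 by (intro grafted_extension_nonempty forest_star_nonempty) simp
    ultimately show ?thesis
      using 3 R.rota_baxter[of "forest_value f" "forest_value f'"]
      by (simp add: grafted_value_def P.add P.scale)
  qed (simp_all add: grafted_value_def)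
qed

lemma extension_diamond:
  assumes "x \<in> nonempty_forests" "y \<in> nonempty_forests"
  shows "extension (diamond w x y) = extension x * extension y"
  using assms(1)
proof (induction x rule: nonempty_forests_induct)
  case (step c F x)
  have "extension (diamond w (basis F) y) = forest_value F * extension y"
    using assms(2)
  proof (induction y rule: nonempty_forests_induct)
    case (step d G y)
    have "extension (forest_diamond w F G) = forest_value F * forest_value G"
      using \<open>F \<noteq> {#}\<close> step.hyps
      by (intro extension_forest_diamond grafted_extension_forest_star)
    with step show ?case
      by (simp add: diamond_right.add diamond_right.scale extension.add extension.scale
        distrib_left scale_mult_right)
  qed simp
  with step show ?case
    by (simp add: diamond_left.add diamond_left.scale extension.add extension.scale
        distrib_right scale_mult_left)
qed simp

lemma rota_baxter_hom_extension:
  "rota_baxter_hom forest_scale nonempty_forests (diamond w) (B_plus 1) scaleR UNIV (*) P w extension"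
  by (intro rota_baxter_hom.intro rota_baxter_nonempty_forests R.rota_baxter_algebra_axioms
      rota_baxter_hom_axioms.intro)
    (simp_all add: extension.add extension.scale extension_diamond extension_B_plus phi_one
      grafted_extension_nonempty)

lemma extension_single_vertex: "extension \<circ> single_vertex = \<phi>"
  by (simp add: fun_eq_iff single_vertex_def value_of_tree_eq grafted_value_def)

lemma concatenation_hom_extension: "concatenation_hom extension"
  by (simp add: concatenation_hom_def forest_value_def)

lemma extension_unique:
  assumes "rota_baxter_hom forest_scale nonempty_forests (diamond w) (B_plus 1) scaleR UNIV (*) P w \<psi>"
    and vertex: "\<psi> \<circ> single_vertex = \<phi>"
    and concat: "concatenation_hom \<psi>"
    and "x \<in> nonempty_forests"
  shows "\<psi> x = extension x"
proof -
  interpret h: rota_baxter_hom forest_scale nonempty_forests "diamond w" "B_plus 1" scaleR UNIV "(*)" P w \<psi>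
    by fact
  have concat_basis: "\<psi> (basis G) = (\<Prod>T\<in>#G. \<psi> (basis {#T#}))" if "G \<noteq> {#}" for G
    using concat that unfolding concatenation_hom_def by blast
  have tree: "\<psi> (basis {#T#}) = value_of_tree T" for T
  proof (induction T)
    case (Node a F)
    show ?case
    proof (cases "F = {#}")
      case True
      then show ?thesis
        using fun_cong[OF vertex, of a] by (simp add: single_vertex_def value_of_tree_eq grafted_value_def)
    next
      case False
      \<comment> \<open>A leaf multiplied by \<open>B_plus 1\<close> recovers \<open>B_plus a\<close>: the star product with the empty
        forest is trivial and \<open>a * 1 = a\<close>.\<close>
      have "basis {#Node a F#} = diamond w (single_vertex a) (B_plus 1 (basis F))"
        by (simp add: single_vertex_def forest_diamond_tree tree_diamond.simps)
      then have "\<psi> (basis {#Node a F#}) = \<psi> (single_vertex a) * P (\<psi> (basis F))"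
        using False by (simp add: h.hom_mult h.hom_P B_plus_nonempty single_vertex_def del: B_plus_basis)
      moreover have "\<psi> (basis F) = forest_value F"
        unfolding concat_basis[OF False] forest_value_def using Node by (simp cong: image_mset_cong)
      ultimately show ?thesis
        using False fun_cong[OF vertex, of a] by (simp add: value_of_tree_eq grafted_value_def)
    qed
  qed
  show ?thesis
    using assms(4)
  proof (induction x rule: nonempty_forests_induct)
    case zero
    then show ?case
      using h.hom_scale[of 0 0] forest.subspace_0[OF subspace_nonempty_forests] by simp
  next
    case (step c F x)
    have "\<psi> (basis F) = forest_value F"
      unfolding concat_basis[OF step.hyps(1)] forest_value_def tree ..
    with step show ?case
      by (simp add: h.hom_add h.hom_scale extension.add extension.scale nonempty_forests_closed)
  qed
qed

end

theorem theorem3p6: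
  fixes scaleA :: "'k::field_char_0 \<Rightarrow> 'a::{comm_ring, comm_monoid_mult} \<Rightarrow> 'a"
    and w :: 'k
  assumes "unital_comm_algebra scaleA"
  shows "rota_baxter_algebra forest_scale (nonempty_forests :: ('a, 'k) forest_space set)
           (diamond w) (B_plus 1) w \<and>
         (\<forall>(scaleR :: 'k \<Rightarrow> 'r::{comm_ring, comm_monoid_mult} \<Rightarrow> 'r) (P :: 'r \<Rightarrow> 'r) (\<phi> :: 'a \<Rightarrow> 'r).
           unital_comm_algebra scaleR \<and> rota_baxter_algebra scaleR UNIV (*) P w \<and>
           unital_algebra_hom scaleA scaleR \<phi> \<longrightarrow>
           (\<exists>\<phi>bar :: ('a, 'k) forest_space \<Rightarrow> 'r.
             rota_baxter_hom forest_scale nonempty_forests (diamond w) (B_plus 1)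
               scaleR UNIV (*) P w \<phi>bar \<and>
             \<phi>bar \<circ> single_vertex = \<phi> \<and>
             concatenation_hom \<phi>bar \<and>
             (\<forall>\<psi> :: ('a, 'k) forest_space \<Rightarrow> 'r.
                rota_baxter_hom forest_scale nonempty_forests (diamond w) (B_plus 1)
                  scaleR UNIV (*) P w \<psi> \<and>
                \<psi> \<circ> single_vertex = \<phi> \<and>
                concatenation_hom \<psi> \<longrightarrow>
                (\<forall>x\<in>nonempty_forests. \<psi> x = \<phi>bar x))))"
proof (intro conjI allI impI)
  show "rota_baxter_algebra forest_scale (nonempty_forests :: ('a, 'k) forest_space set)
      (diamond w) (B_plus 1) w"
    by (rule rota_baxter_nonempty_forests)
next
  fix scaleR :: "'k \<Rightarrow> 'r \<Rightarrow> 'r" and P :: "'r \<Rightarrow> 'r" and \<phi> :: "'a \<Rightarrow> 'r"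
  assume "unital_comm_algebra scaleR \<and> rota_baxter_algebra scaleR UNIV (*) P w \<and>
    unital_algebra_hom scaleA scaleR \<phi>"
  then interpret rota_baxter_target scaleR P w \<phi>
    by (intro rota_baxter_target.intro rota_baxter_target_axioms.intro)
      (auto simp: unital_algebra_hom.hom_mult unital_algebra_hom.hom_one)
  show "\<exists>\<phi>bar :: ('a, 'k) forest_space \<Rightarrow> 'r.
      rota_baxter_hom forest_scale nonempty_forests (diamond w) (B_plus 1) scaleR UNIV (*) P w \<phi>bar \<and>
      \<phi>bar \<circ> single_vertex = \<phi> \<and> concatenation_hom \<phi>bar \<and>
      (\<forall>\<psi>. rota_baxter_hom forest_scale nonempty_forests (diamond w) (B_plus 1)
          scaleR UNIV (*) P w \<psi> \<and> \<psi> \<circ> single_vertex = \<phi> \<and> concatenation_hom \<psi> \<longrightarrow>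
        (\<forall>x\<in>nonempty_forests. \<psi> x = \<phi>bar x))"
    by (intro exI [of _ extension] conjI allI impI ballI rota_baxter_hom_extension
        extension_single_vertex concatenation_hom_extension) (elim conjE, rule extension_unique)
qed

end
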